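(* If $s\in\mathbb N$ is odd and $\ell(s)=\infty$, then the trajectory of $s$ reaches $1$, i.e. $T^k(s)=1$ for some $k\geq0$.
   Context: $\mathbb N$ denotes the positive integers. The Collatz function $T:\mathbb N\to\mathbb N$ is $T(n)=n/2$ if $n$ is even and $T(n)=(3n+1)/2$ if $n$ is odd; $T^0(s)=s$ and $T^k(s)=T(T^{k-1}(s))$ for $k\geq1$; the trajectory of $s$ is $(T^k(s))_{k\geq0}$. For odd $s\in\mathbb N$, the cut time is $$\ell(s)=\min\{k\geq1 : T^k(s)\equiv 3\pmod 4 \text{ and } T^{k-1}(s)\text{ is even}\},$$ with $\ell(s)=\infty$ if this set is empty. *)

theory Defs
  imports Main "HOL-Library.Extended_Nat"
begin

(* The domain of the Collatz function is the set of positive integers; on the type nat the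
   extra value T 0 = 0 is irrelevant, since T maps positive numbers to positive numbers. *)
definition collatz_T :: "nat \<Rightarrow> nat" where
  "collatz_T n = (if even n then n div 2 else (3 * n + 1) div 2)"

definition cut_set :: "nat \<Rightarrow> nat set" where
  "cut_set s = {k. k \<ge> 1 \<and> (collatz_T ^^ k) s mod 4 = 3 \<and> even ((collatz_T ^^ (k - 1)) s)}"

(* Meaningful for odd s only. *)
definition cut_time :: "nat \<Rightarrow> enat" where
  "cut_time s = (if cut_set s = {} then \<infinity> else enat (LEAST k. k \<in> cut_set s))"

end

(* Along a run of odd values n + 1 is multiplied by 3/2 in each step, so the run is finite and some
   iterate is even.  Without a cut, no even value is followed by a value congruent to 3 modulo 4.
   Hence from then on every value x is even or congruent to 1 modulo 4; it drops to x/2 in one step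
   in the first case and to (3x+1)/4 < x in two steps in the second, unless x = 1. *)
theory Submission
  imports Defs
begin

lemma collatz_T_pos: "n > 0 \<Longrightarrow> collatz_T n > 0"
  by (auto simp: collatz_T_def elim!: evenE)

lemma collatz_T_funpow_pos: "n > 0 \<Longrightarrow> (collatz_T ^^ k) n > 0"
  by (induction k) (auto simp: collatz_T_pos)

text \<open>For odd \<open>n\<close>, \<open>2 * (collatz_T n + 1) = 3 * (n + 1)\<close>. So each
  odd step removes exactly one factor 2 from the value plus one, the factor 3 being coprime to
  powers of 2.\<close>

lemma power_two_dvd_if_odd_run:
  "(\<And>j. j < k \<Longrightarrow> odd ((collatz_T ^^ j) n)) \<Longrightarrow> 2 ^ k dvd n + 1"
proof (induction k arbitrary: n)
  case 0
  then show ?case by simp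
next
  case (Suc k)
  have "odd n"
    using Suc.prems[of 0] by simp
  have "odd ((collatz_T ^^ j) (collatz_T n))" if "j < k" for j
    using Suc.prems[of "Suc j"] that by (simp add: funpow_swap1)
  then have "2 ^ k dvd collatz_T n + 1"
    by (rule Suc.IH)
  then have "2 ^ Suc k dvd 2 * (collatz_T n + 1)"
    unfolding power_Suc by (rule mult_dvd_mono[OF dvd_refl])
  also have "2 * (collatz_T n + 1) = 3 * (n + 1)"
    using \<open>odd n\<close> by (auto simp: collatz_T_def elim!: oddE)
  finally show ?case
    using coprime_dvd_mult_right_iff[of "2 ^ Suc k" "3 :: nat" "n + 1"] by simp
qed

lemma ex_even_collatz_iterate: "\<exists>j. even ((collatz_T ^^ j) n)"
proof (rule ccontr)
  assume "\<nexists>j. even ((collatz_T ^^ j) n)"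
  \<comment> \<open>Any exponent \<open>k\<close> with \<open>2 ^ k > n + 1\<close> would do;
    \<open>n + 1\<close> is a convenient choice.\<close>
  then have "2 ^ (n + 1) dvd n + 1"
    using power_two_dvd_if_odd_run by blast
  then have "2 ^ (n + 1) \<le> n + 1"
    by (rule dvd_imp_le) simp
  then show False
    using less_exp[of "n + 1"] by simp
qed

lemma cut_set_funpow_empty:
  assumes "cut_set n = {}"
  shows "cut_set ((collatz_T ^^ j) n) = {}"
proof -
  have "k + j \<in> cut_set n" if "k \<in> cut_set ((collatz_T ^^ j) n)" for k
  proof -
    \<comment> \<open>Since \<open>k \<ge> 1\<close>, the truncated subtraction is harmless:
      \<open>(k + j) - 1 = (k - 1) + j\<close>, so the even predecessor is the same value in both
      trajectories.\<close>
    obtain i where "k = Suc i"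
      using \<open>k \<in> _\<close> by (cases k) (auto simp: cut_set_def)
    then show ?thesis
      using that by (simp add: cut_set_def funpow_add)
  qed
  with assms show ?thesis
    by blast
qed

lemma cut_set_collatz_T_empty: "cut_set n = {} \<Longrightarrow> cut_set (collatz_T n) = {}"
  using cut_set_funpow_empty[of n 1] by simp

lemma collatz_T_mod_4_if_no_cut:
  assumes "cut_set n = {}" and "even n"
  shows "collatz_T n mod 4 \<noteq> 3"
proof
  assume "collatz_T n mod 4 = 3"
  then have "1 \<in> cut_set n"
    using assms(2) by (simp add: cut_set_def)
  then show False
    using assms(1) by simp
qed

text \<open>Strong induction on the value. The condition modulo 4 is an invariant because the
  induction hypothesis is only ever applied to the successor of an even value.\<close>

lemma reaches_one_if_no_cut:
  "n > 0 \<Longrightarrow> n mod 4 \<noteq> 3 \<Longrightarrow> cut_set n = {} \<Longrightarrow> \<exists>k. (collatz_T ^^ k) n = 1"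
proof (induction n rule: less_induct)
  case (less n)
  consider "n = 1" | "even n" | "odd n" "n \<noteq> 1" by blast
  then show ?case
  proof cases
    case 1
    then have "(collatz_T ^^ 0) n = 1" by simp
    then show ?thesis ..
  next
    case 2
    then have "collatz_T n < n"
      using less.prems(1) by (simp add: collatz_T_def)
    then obtain k where "(collatz_T ^^ k) (collatz_T n) = 1"
      using less.IH[of "collatz_T n"] less.prems 2
      by (auto simp: collatz_T_pos cut_set_collatz_T_empty collatz_T_mod_4_if_no_cut)
    then have "(collatz_T ^^ Suc k) n = 1"
      by (simp add: funpow_swap1)
    then show ?thesis ..
  next
    case 3
    have "n mod 4 = 1"
      using 3(1) less.prems(2) by presburger
    define m where "m = n div 4"
    have n: "n = 4 * m + 1" and "m > 0"
      using \<open>n mod 4 = 1\<close> 3(2) unfolding m_def by presburger+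
    have T: "collatz_T n = 6 * m + 2"
      by (simp add: n collatz_T_def)
    have TT: "collatz_T (collatz_T n) = 3 * m + 1"
      by (simp add: T) (simp add: collatz_T_def)
    \<comment> \<open>The intermediate value \<open>6 * m + 2\<close> is even, so a residue 3 here
      would be a cut.\<close>
    have "collatz_T (collatz_T n) mod 4 \<noteq> 3"
      using less.prems(3)
      by (intro collatz_T_mod_4_if_no_cut cut_set_collatz_T_empty) (auto simp: T)
    \<comment> \<open>\<open>3 * m + 1 < 4 * m + 1\<close> is strict exactly because
      \<open>n \<noteq> 1\<close> gives \<open>m > 0\<close>.\<close>
    moreover have "collatz_T (collatz_T n) < n"
      using n TT \<open>m > 0\<close> by simp
    ultimately obtain k where "(collatz_T ^^ k) (collatz_T (collatz_T n)) = 1"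
      using less.IH[of "collatz_T (collatz_T n)"] less.prems
      by (auto simp: collatz_T_pos cut_set_collatz_T_empty)
    then have "(collatz_T ^^ Suc (Suc k)) n = 1"
      by (simp add: funpow_swap1)
    then show ?thesis ..
  qed
qed

theorem lemma3p4:
  fixes s :: nat
  assumes "s > 0" and "odd s" and "cut_time s = \<infinity>"
  shows "\<exists>k. (collatz_T ^^ k) s = 1"
proof -
  have no_cut: "cut_set s = {}"
    using assms(3) by (simp add: cut_time_def split: if_splits)
  \<comment> \<open>The induction cannot start at \<open>s\<close>, which may itself be 3 modulo 4;
    an even iterate is a valid start.\<close>
  obtain j where "even ((collatz_T ^^ j) s)"
    using ex_even_collatz_iterate by blast
  then have "(collatz_T ^^ j) s mod 4 \<noteq> 3"
    using dvd_mod[of 2 "(collatz_T ^^ j) s" 4] by auto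
  then obtain k where "(collatz_T ^^ k) ((collatz_T ^^ j) s) = 1"
    using reaches_one_if_no_cut collatz_T_funpow_pos[OF assms(1)] cut_set_funpow_empty[OF no_cut]
    by blast
  then have "(collatz_T ^^ (k + j)) s = 1"
    by (simp add: funpow_add)
  then show ?thesis ..
qed

end
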